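(* Let $\mu$ be a continuous probability measure on $\mathbb{R}$ with distribution function $F(x)=\mu((-\infty,x])$, and let $F^{-1}(u)=\inf\{x\in\mathbb{R} : F(x)\ge u\}$ be its generalised inverse. Let $n\ge 2$ be an integer. For $i=1,\dots,n$ let $u_i(u)=\frac{u}{n}+\frac{i-1}{n}$ for $0\le u\le 1$, and define $$f_i(x)=F^{-1}\bigl(u_i(F(x))\bigr)\qquad\text{for every } x\in\mathbb{R} \text{ with } F(x)>0 .$$ Then the maps $f_1,\dots,f_n$ are monotone, and $\mu$ is the measure-attractor of the iterated function system with maps $f_1,\dots,f_n$ and probabilities $p_i=1/n$, $i=1,\dots,n$.
   Context: A probability measure $\mu$ on $\mathbb{R}$ is called continuous if its distribution function $F$ is a continuous function (equivalently, $\mu(\{x\})=0$ for every $x\in\mathbb{R}$). An iterated function system with probabilities consists of functions $f_1,\dots,f_n$ together with non-negative numbers $p_1,\dots,p_n$ with $\sum_{i=1}^n p_i=1$. Its measure-attractor is the unique Borel probability measure $\nu$ satisfying the invariance equation $$\nu(B)=\sum_{i=1}^n p_i\,\nu\bigl(f_i^{-1}(B)\bigr)\qquad\text{for all Borel sets } B\subseteq\mathbb{R}.$$ Thus the assertion that $\mu$ is the measure-attractor means that $\mu$ satisfies this equation and is the only Borel probability measure on $\mathbb{R}$ that does so. Equivalently, $\mu$ is the unique stationary distribution of the Markov chain $X_{k+1}=f_{I_{k+1}}(X_k)$, where $I_1,I_2,\dots$ are independent random variables with $P(I_k=i)=p_i$, independent of $X_0$. Here the maps $f_i$ are defined on the set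 $D=\{x\in\mathbb{R}:F(x)>0\}$, and $f_i^{-1}(B)$ denotes $\{x\in D: f_i(x)\in B\}$. Monotone means non-decreasing. *)

theory Defs
  imports "HOL-Probability.Probability"
begin

definition gen_inverse :: "(real \<Rightarrow> real) \<Rightarrow> real \<Rightarrow> real" where
  "gen_inverse F u = Inf {x. F x \<ge> u}"

text \<open>
  The maps \<open>f 1, \<dots>, f n\<close> of an iterated function system live on \<open>D\<close>; their values outside \<open>D\<close>
  are irrelevant. Measurability is part of the notion, since otherwise the library function
  \<^const>\<open>measure\<close> would silently assign the value 0 to a non-measurable preimage below.
\<close>

definition ifs_with_probs ::
  "real set \<Rightarrow> nat \<Rightarrow> (nat \<Rightarrow> real \<Rightarrow> real) \<Rightarrow> (nat \<Rightarrow> real) \<Rightarrow> bool" where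
  "ifs_with_probs D n f p \<longleftrightarrow>
     D \<in> sets borel \<and>
     (\<forall>i\<in>{1..n}. f i \<in> borel_measurable (restrict_space borel D)) \<and>
     (\<forall>i\<in>{1..n}. 0 \<le> p i) \<and> (\<Sum>i=1..n. p i) = 1"

definition ifs_invariant ::
  "real set \<Rightarrow> nat \<Rightarrow> (nat \<Rightarrow> real \<Rightarrow> real) \<Rightarrow> (nat \<Rightarrow> real) \<Rightarrow> real measure \<Rightarrow> bool" where
  "ifs_invariant D n f p \<nu> \<longleftrightarrow>
     (\<forall>B\<in>sets borel. measure \<nu> B = (\<Sum>i=1..n. p i * measure \<nu> {x\<in>D. f i x \<in> B}))"

text \<open>
  The competitors \<open>\<nu>\<close> range over all Borel probability measures on the real line; they are not
  assumed to be concentrated on \<open>D\<close>.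
\<close>

definition measure_attractor ::
  "real set \<Rightarrow> nat \<Rightarrow> (nat \<Rightarrow> real \<Rightarrow> real) \<Rightarrow> (nat \<Rightarrow> real) \<Rightarrow> real measure \<Rightarrow> bool" where
  "measure_attractor D n f p \<mu> \<longleftrightarrow>
     ifs_with_probs D n f p \<and>
     real_distribution \<mu> \<and> ifs_invariant D n f p \<mu> \<and>
     (\<forall>\<nu>. real_distribution \<nu> \<and> ifs_invariant D n f p \<nu> \<longrightarrow> \<nu> = \<mu>)"

definition u_map :: "nat \<Rightarrow> nat \<Rightarrow> real \<Rightarrow> real" where
  "u_map n i u = u / real n + (real i - 1) / real n"

definition cdf_domain :: "real measure \<Rightarrow> real set" where
  "cdf_domain \<mu> = {x. cdf \<mu> x > 0}"

text \<open>
  Only the values for \<open>x \<in> cdf_domain \<mu>\<close> and \<open>1 \<le> i \<le> n\<close> matter. There, the argument of the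
  generalised inverse is positive, at most 1, and below 1 unless \<open>cdf \<mu> x = 1\<close>, so the infimum is
  that of a nonempty set bounded below.
\<close>

definition f_map :: "real measure \<Rightarrow> nat \<Rightarrow> nat \<Rightarrow> real \<Rightarrow> real" where
  "f_map \<mu> n i x = gen_inverse (cdf \<mu>) (u_map n i (cdf \<mu> x))"

end

theory Submission
  imports Defs
begin

text \<open>
  Write \<open>F\<close> for the distribution function of \<open>\<mu>\<close>. Since \<open>F\<close> is continuous, \<open>F (F\<^sup>-\<^sup>1 v) = v\<close>
  for all \<open>v > 0\<close> that \<open>F\<close> reaches, so \<open>F\<close> carries the maps \<open>f i\<close> to the affine maps \<open>u i\<close>,
  that is \<open>F (f i x) = u i (F x)\<close> (\<open>cdf_f_map\<close>); and it carries \<open>\<mu>\<close> to the uniform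
  distribution on \<open>[0, 1]\<close> (\<open>prob_cdf_le\<close>). The \<open>u i\<close> map \<open>[0, 1]\<close> onto the \<open>n\<close> intervals
  \<open>[(i - 1) / n, i / n]\<close>, and everything reduces to two facts about this model system.

  The uniform distribution is invariant, which amounts to an identity for its distribution function
  (\<open>uniform_cdf_self_similar\<close>). Pulled back along \<open>F\<close>, it gives the invariance equation of \<open>\<mu>\<close> for
  the half-lines \<open>{..y}\<close>, because \<open>f i x \<le> y\<close> is equivalent to a bound on \<open>F x\<close>
  (\<open>f_map_le_iff\<close>). Half-lines generate the Borel sets.

  Uniqueness is a contraction argument (\<open>self_similar_cdf_unique\<close>): if \<open>\<nu>\<close> is invariant, then
  \<open>G t = \<nu> {x. F x \<le> t}\<close> satisfies the same identity as the uniform distribution function, and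
  as the images of the \<open>u i\<close> have at most end points in common, the identity shrinks the supremum distance of two
  solutions by the factor \<open>1 / n\<close>. Hence \<open>\<nu>\<close>, too, is carried to the uniform distribution. Although
  \<open>F\<close> need not be injective, this determines \<open>\<nu>\<close>: for each \<open>y\<close>, the half-line \<open>{..y}\<close> lies
  between \<open>{x. F x < F y}\<close> and \<open>{x. F x \<le> F y}\<close>, both of \<open>\<nu>\<close>-measure \<open>F y\<close>
  (\<open>eq_if_cdf_image_uniform\<close>).
\<close>


section \<open>The uniform distribution function and its self-similarity\<close>

definition uniform_cdf :: "real \<Rightarrow> real" where
  "uniform_cdf t = max 0 (min 1 t)"

lemma sum_uniform_cdf_shift:
  "(\<Sum>i=1..n. uniform_cdf (s - (real i - 1))) = max 0 (min (real n) s)"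
  by (induction n) (auto simp: uniform_cdf_def max_def min_def)

lemma uniform_cdf_self_similar:
  assumes "n \<ge> 1"
  shows "uniform_cdf t = (\<Sum>i=1..n. uniform_cdf (real n * t - (real i - 1))) / real n"
proof -
  have "max 0 (min (real n) (real n * t)) = real n * uniform_cdf t"
    using assms by (auto simp: uniform_cdf_def max_def min_def zero_le_mult_iff)
  then show ?thesis
    unfolding sum_uniform_cdf_shift using assms by simp
qed

text \<open>
  The self-similarity equation contracts: two solutions agree outside \<open>(0, 1)\<close>, and the arguments
  \<open>n * t - (i - 1)\<close> are spaced by 1, so at most one summand contributes to their difference at \<open>t\<close>.
\<close>

lemma self_similar_cdf_unique:
  fixes G :: "real \<Rightarrow> real"
  assumes n: "n \<ge> 2"
    and range: "\<And>t. 0 \<le> G t" "\<And>t. G t \<le> 1"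
    and left: "\<And>t. t \<le> 0 \<Longrightarrow> G t = 0"
    and right: "\<And>t. t \<ge> 1 \<Longrightarrow> G t = 1"
    and self_similar: "\<And>t. G t = (\<Sum>i=1..n. G (real n * t - (real i - 1))) / real n"
  shows "G = uniform_cdf"
proof
  fix t
  define d where "d t = \<bar>G t - uniform_cdf t\<bar>" for t
  have outside: "d t = 0" if "t \<le> 0 \<or> 1 \<le> t" for t
    using that left right by (auto simp: d_def uniform_cdf_def)
  have d_self_similar: "d t \<le> (\<Sum>i=1..n. d (real n * t - (real i - 1))) / real n" for t
  proof -
    have "G t - uniform_cdf t =
        (\<Sum>i=1..n. G (real n * t - (real i - 1)) - uniform_cdf (real n * t - (real i - 1))) / real n"
      using self_similar[of t] uniform_cdf_self_similar[of n t] n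
      by (simp add: sum_subtractf diff_divide_distrib)
    then show ?thesis
      unfolding d_def by (simp add: abs_divide divide_right_mono sum_abs)
  qed
  have contract: "d t \<le> c / real n" if bound: "\<And>t. d t \<le> c" for t c
  proof -
    let ?s = "\<lambda>i. real n * t - (real i - 1)"
    let ?j = "nat \<lceil>real n * t\<rceil>"
    have "0 \<le> c"
      using bound[of 0] by (simp add: d_def)
    (* Only the index ?j can have its argument in the open unit interval. *)
    have "d (?s i) \<le> (if i = ?j then c else 0)" for i
    proof (cases "i = ?j")
      case False
      then have "?s i \<le> 0 \<or> 1 \<le> ?s i"
        by linarith
      then show ?thesis
        using False outside by simp
    qed (use bound in simp)
    then have "(\<Sum>i=1..n. d (?s i)) \<le> (\<Sum>i=1..n. if i = ?j then c else 0)"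
      by (intro sum_mono)
    also have "\<dots> \<le> c"
      using \<open>0 \<le> c\<close> by simp
    finally show ?thesis
      using d_self_similar[of t] n by (meson divide_right_mono of_nat_0_le_iff order_trans)
  qed
  have power_bound: "d t \<le> (1 / real n) ^ m" for m t
  proof (induction m arbitrary: t)
    case 0
    show ?case
      using range[of t] by (auto simp: d_def uniform_cdf_def)
  next
    case (Suc m)
    show ?case
      using contract[of "(1 / real n) ^ m" t] Suc by simp
  qed
  have "(\<lambda>m. (1 / real n) ^ m) \<longlonglongrightarrow> 0"
    using n by (intro LIMSEQ_power_zero) auto
  then have "d t \<le> 0"
    by (rule LIMSEQ_le_const) (use power_bound in blast)
  then show "G t = uniform_cdf t"
    by (simp add: d_def)
qed


section \<open>Continuous distribution functions and the maps of the system\<close>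

lemma u_map_le_iff:
  assumes "i \<in> {1..n}"
  shows "u_map n i s \<le> t \<longleftrightarrow> s \<le> real n * t - (real i - 1)"
proof -
  have "u_map n i s = (s + (real i - 1)) / real n" "0 < real n"
    using assms by (auto simp: u_map_def add_divide_distrib)
  then show ?thesis
    by (simp only: pos_divide_le_eq le_diff_eq mult.commute)
qed

context real_distribution
begin

lemma cdf_borel_measurable [measurable]: "cdf M \<in> borel_measurable borel"
  by (intro borel_measurable_mono monoI cdf_nondecreasing)

lemma atMost_subset_cdf_le: "{..z} \<subseteq> {x. cdf M x \<le> cdf M z}"
  using cdf_nondecreasing by auto

lemma cdf_le_subset_atMost:
  assumes "s < cdf M z"
  shows "{x. cdf M x \<le> s} \<subseteq> {..z}"
proof
  fix x assume "x \<in> {x. cdf M x \<le> s}"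
  then show "x \<in> {..z}"
    using assms cdf_nondecreasing[of z x] by fastforce
qed

lemma cdf_le_borel [measurable]: "{x. cdf M x \<le> t} \<in> sets borel"
  by measurable

lemma exists_cdf_less:
  assumes "0 < v"
  obtains a where "cdf M a < v" "a \<le> b"
proof -
  have "\<forall>\<^sub>F a in at_bot. cdf M a < v \<and> a \<le> b"
    using order_tendstoD(2)[OF cdf_lim_at_bot assms] eventually_le_at_bot[of b]
    by (rule eventually_conj)
  then show ?thesis
    using that by (auto simp: eventually_at_bot_linorder)
qed

lemma exists_cdf_gt:
  assumes "v < 1"
  shows "\<exists>b. v < cdf M b"
  using order_tendstoD(1)[OF cdf_lim_at_top_prob assms] by (auto simp: eventually_at_top_linorder)

text \<open>
  Positivity of \<open>v\<close> keeps the infimum away from \<open>-\<infinity>\<close>, and the witness \<open>b\<close> keeps it away from the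
  infimum of the empty set. The value \<open>v = 1\<close> is therefore covered when \<open>F\<close> attains it.
\<close>

lemma cdf_gen_inverse:
  assumes cont: "continuous_on UNIV (cdf M)" and "0 < v" and b: "v \<le> cdf M b"
  shows "cdf M (gen_inverse (cdf M) v) = v"
    and "gen_inverse (cdf M) v \<le> y \<longleftrightarrow> v \<le> cdf M y"
proof -
  let ?A = "{x. v \<le> cdf M x}" and ?g = "gen_inverse (cdf M) v"
  obtain a where a: "cdf M a < v" "a \<le> b"
    using exists_cdf_less[OF \<open>0 < v\<close>] .
  have bdd: "bdd_below ?A"
  proof (rule bdd_belowI)
    fix x assume "x \<in> ?A"
    then show "a \<le> x"
      using a cdf_nondecreasing[of x a] by fastforce
  qed
  have lower: "?g \<le> x" if "v \<le> cdf M x" for x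
    unfolding gen_inverse_def using that bdd by (intro cInf_lower) auto
  obtain z where z: "cdf M z = v"
    using IVT'[of "cdf M" a v b] a b cont by (auto intro: continuous_on_subset)
  have "closed ?A"
    using cont by (intro closed_Collect_le continuous_on_const)
  then have "v \<le> cdf M ?g"
    unfolding gen_inverse_def using closed_contains_Inf[of ?A] b bdd by auto
  moreover have "cdf M ?g \<le> v"
    using cdf_nondecreasing[OF lower[of z]] z by simp
  ultimately show eq: "cdf M ?g = v"
    by simp
  show "?g \<le> y \<longleftrightarrow> v \<le> cdf M y"
    using lower cdf_nondecreasing[of ?g y] eq by auto
qed

text \<open>
  On the domain, \<open>u i (F x)\<close> reaches the critical value 1 only for \<open>i = n\<close> and \<open>F x = 1\<close>, and then
  \<open>x\<close> itself shows that \<open>F\<close> attains it.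
\<close>

lemma u_map_attained:
  assumes "x \<in> cdf_domain M" "i \<in> {1..n}"
  shows "0 < u_map n i (cdf M x)" "\<exists>b. u_map n i (cdf M x) \<le> cdf M b"
proof -
  let ?v = "u_map n i (cdf M x)"
  have i: "1 \<le> real i" "real i \<le> real n" "0 < real n"
    using assms by auto
  have x: "0 < cdf M x" "cdf M x \<le> 1"
    using assms cdf_bounded_prob by (auto simp: cdf_domain_def)
  have v: "?v = (cdf M x + (real i - 1)) / real n"
    by (simp add: u_map_def add_divide_distrib)
  show "0 < ?v"
    using i x by (simp add: v)
  show "\<exists>b. ?v \<le> cdf M b"
  proof (cases "cdf M x = 1")
    case True
    then have "?v \<le> cdf M x"
      unfolding v using i by (simp add: divide_le_eq)
    then show ?thesis ..
  next
    case False
    then have "?v < 1"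
      unfolding v using i x by (simp add: divide_less_eq)
    then show ?thesis
      using exists_cdf_gt less_imp_le by blast
  qed
qed

lemma cdf_f_map:
  assumes "continuous_on UNIV (cdf M)" "x \<in> cdf_domain M" "i \<in> {1..n}"
  shows "cdf M (f_map M n i x) = u_map n i (cdf M x)"
  using u_map_attained[OF assms(2,3)] cdf_gen_inverse(1)[OF assms(1)] by (auto simp: f_map_def)

text \<open>
  The generalised inverse is the lower adjoint of \<open>F\<close>, so a bound on \<open>f i x\<close> becomes a bound on
  \<open>F x\<close>. This yields monotonicity as well as the preimages of half-lines, without a formula
  for \<open>F\<^sup>-\<^sup>1\<close>.
\<close>

lemma f_map_le_iff:
  assumes "continuous_on UNIV (cdf M)" "x \<in> cdf_domain M" "i \<in> {1..n}"
  shows "f_map M n i x \<le> y \<longleftrightarrow> cdf M x \<le> real n * cdf M y - (real i - 1)"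
  using u_map_attained[OF assms(2,3)] cdf_gen_inverse(2)[OF assms(1)] u_map_le_iff[OF assms(3)]
  by (auto simp: f_map_def)

lemma mono_on_f_map:
  assumes "continuous_on UNIV (cdf M)" "i \<in> {1..n}"
  shows "mono_on (cdf_domain M) (f_map M n i)"
proof (rule mono_onI)
  fix x y assume x: "x \<in> cdf_domain M" and y: "y \<in> cdf_domain M" and "x \<le> y"
  have "cdf M y \<le> real n * cdf M (f_map M n i y) - (real i - 1)"
    using f_map_le_iff[OF assms(1) y assms(2), of "f_map M n i y"] by simp
  then show "f_map M n i x \<le> f_map M n i y"
    using f_map_le_iff[OF assms(1) x assms(2)] cdf_nondecreasing[OF \<open>x \<le> y\<close>] by simp
qed

lemma cdf_domain_borel: "cdf_domain M \<in> sets borel"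
  unfolding cdf_domain_def by measurable

lemma f_map_borel_measurable:
  assumes "continuous_on UNIV (cdf M)" "i \<in> {1..n}"
  shows "f_map M n i \<in> borel_measurable (restrict_space borel (cdf_domain M))"
  using mono_on_f_map[OF assms] by (rule borel_measurable_mono_on_fnc)

lemma f_map_preimage_borel:
  assumes "continuous_on UNIV (cdf M)" "i \<in> {1..n}" "B \<in> sets borel"
  shows "{x \<in> cdf_domain M. f_map M n i x \<in> B} \<in> sets borel"
proof -
  have "f_map M n i -` B \<inter> space (restrict_space borel (cdf_domain M))
      \<in> sets (restrict_space borel (cdf_domain M))"
    by (rule measurable_sets[OF f_map_borel_measurable[OF assms(1,2)] assms(3)])
  also have "f_map M n i -` B \<inter> space (restrict_space borel (cdf_domain M)) =
      {x \<in> cdf_domain M. f_map M n i x \<in> B}"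
    by (auto simp: space_restrict_space)
  finally show ?thesis
    using cdf_domain_borel by (simp add: sets_restrict_space_iff)
qed

end


section \<open>Invariance\<close>

lemma (in prob_space) prob_Int_of_prob_1:
  assumes "A \<in> events" "D \<in> events" "prob D = 1"
  shows "prob (A \<inter> D) = prob A"
  using assms AE_in_set_eq_1[OF assms(2)] by (intro finite_measure_eq_AE) auto

context real_distribution
begin

text \<open>
  The probability integral transform. Where \<open>F\<close> has a plateau at height \<open>t\<close>, the set
  \<open>{x. F x \<le> t}\<close> may be larger than \<open>{..z}\<close> for a given \<open>z\<close> with \<open>F z = t\<close>; it is bounded from above by
  the half-lines \<open>{..z}\<close> with \<open>F z > t\<close> instead.
\<close>

lemma prob_cdf_le:
  assumes cont: "continuous_on UNIV (cdf M)"
  shows "prob {x. cdf M x \<le> t} = uniform_cdf t"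
proof -
  have attained: "\<exists>z. cdf M z = s" if "0 < s" "s < 1" for s
    using exists_cdf_gt[OF \<open>s < 1\<close>] cdf_gen_inverse(1)[OF cont \<open>0 < s\<close>] by (meson less_imp_le)
  consider "t < 0" | "0 \<le> t" "t < 1" | "1 \<le> t"
    by linarith
  then show ?thesis
  proof cases
    case 1
    then have "{x. cdf M x \<le> t} = {}"
      using cdf_nonneg by (auto simp: not_le intro: less_le_trans)
    then show ?thesis
      using 1 by (simp add: uniform_cdf_def)
  next
    case 2
    have "t \<le> prob {x. cdf M x \<le> t}"
    proof (cases "t = 0")
      case False
      then obtain z where z: "cdf M z = t"
        using 2 attained[of t] by auto
      have "cdf M z \<le> prob {x. cdf M x \<le> t}"
        unfolding cdf_def2[of M z] using atMost_subset_cdf_le[of z] z cdf_le_borel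
        by (intro finite_measure_mono) simp_all
      then show ?thesis
        using z by simp
    qed simp
    moreover have "prob {x. cdf M x \<le> t} \<le> t"
    proof (rule dense_ge_bounded[OF \<open>t < 1\<close>])
      fix s assume s: "t < s" "s < 1"
      then obtain z where z: "cdf M z = s"
        using 2 attained[of s] by auto
      have "{x. cdf M x \<le> t} \<subseteq> {..z}"
        using cdf_le_subset_atMost z s by simp
      then have "prob {x. cdf M x \<le> t} \<le> cdf M z"
        unfolding cdf_def2[of M z] by (intro finite_measure_mono) auto
      then show "prob {x. cdf M x \<le> t} \<le> s"
        using z by simp
    qed
    ultimately show ?thesis
      using 2 by (simp add: uniform_cdf_def)
  next
    case 3
    then have "{x. cdf M x \<le> t} = space M"
      using order_trans[OF cdf_bounded_prob] by auto
    then show ?thesis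
      using 3 by (simp add: prob_space uniform_cdf_def del: space_eq_univ)
  qed
qed

lemma prob_cdf_domain:
  assumes "continuous_on UNIV (cdf M)"
  shows "prob (cdf_domain M) = 1"
proof -
  have "{x. cdf M x \<le> 0} = space M - cdf_domain M"
    by (auto simp: cdf_domain_def not_less)
  then show ?thesis
    using prob_cdf_le[OF assms, of 0] prob_compl[of "cdf_domain M"] cdf_domain_borel
    by (simp add: uniform_cdf_def)
qed

text \<open>
  The sets that satisfy the invariance equation form a Dynkin system; closure under complements
  uses that \<open>\<mu>\<close> is concentrated on the domain of the maps.
\<close>

lemma ifs_invariant_f_map:
  assumes cont: "continuous_on UNIV (cdf M)" and n: "n \<ge> 1"
  shows "ifs_invariant (cdf_domain M) n (f_map M n) (\<lambda>i. 1 / real n) M"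
  unfolding ifs_invariant_def
proof
  let ?D = "cdf_domain M"
  let ?P = "\<lambda>i B. {x \<in> ?D. f_map M n i x \<in> B}"
  note P_events = f_map_preimage_borel[OF cont]
  note D_events = cdf_domain_borel
  fix B :: "real set" assume "B \<in> sets borel"
  moreover have borel_eq: "sets borel = sigma_sets UNIV (range (\<lambda>y::real. {..y}))"
    by (subst borel_eq_atMost) simp
  moreover have "Int_stable (range (\<lambda>y::real. {..y}))"
    by (auto simp: Int_stable_def)
  moreover have "range (\<lambda>y::real. {..y}) \<subseteq> Pow UNIV"
    by simp
  ultimately have "Int_stable (range (\<lambda>y::real. {..y}))" "range (\<lambda>y::real. {..y}) \<subseteq> Pow UNIV"
    "B \<in> sigma_sets UNIV (range (\<lambda>y::real. {..y}))"
    by simp_all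
  then show "prob B = (\<Sum>i=1..n. 1 / real n * prob (?P i B))"
  proof (induction rule: sigma_sets_induct_disjoint[consumes 3, case_names basic empty compl union])
    case (basic A)
    then obtain y where A: "A = {..y}"
      by auto
    have "prob (?P i A) = uniform_cdf (real n * cdf M y - (real i - 1))" if i: "i \<in> {1..n}" for i
    proof -
      let ?s = "real n * cdf M y - (real i - 1)"
      have "?P i A = {x. cdf M x \<le> ?s} \<inter> ?D"
        using f_map_le_iff[OF cont _ i] by (auto simp: A)
      moreover have "{x. cdf M x \<le> ?s} \<in> events"
        by simp
      ultimately show ?thesis
        using prob_cdf_le[OF cont, of ?s] prob_Int_of_prob_1[OF _ _ prob_cdf_domain[OF cont]]
          D_events by simp
    qed
    then have "(\<Sum>i=1..n. 1 / real n * prob (?P i A)) = uniform_cdf (cdf M y)"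
      using uniform_cdf_self_similar[OF n, of "cdf M y"] by (simp add: sum_divide_distrib)
    also have "\<dots> = prob A"
      using cdf_nonneg cdf_bounded_prob by (simp add: uniform_cdf_def A cdf_def)
    finally show ?case ..
  next
    case empty
    show ?case
      by simp
  next
    case (compl A)
    then have A: "A \<in> sets borel"
      by (simp add: borel_eq)
    have "prob (?P i (UNIV - A)) = 1 - prob (?P i A)" if i: "i \<in> {1..n}" for i
    proof -
      have "?P i (UNIV - A) = ?D - ?P i A"
        by auto
      then show ?thesis
        using finite_measure_Diff[of ?D "?P i A"] P_events[OF i A] D_events prob_cdf_domain[OF cont]
        by auto
    qed
    then have "(\<Sum>i=1..n. 1 / real n * prob (?P i (UNIV - A))) =
        1 - (\<Sum>i=1..n. 1 / real n * prob (?P i A))"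
      using n by (simp add: right_diff_distrib sum_subtractf)
    then show ?case
      using compl.IH prob_compl[of A] A by simp
  next
    case (union A)
    then have A: "A k \<in> sets borel" for k
      by (auto simp: borel_eq)
    have "(\<lambda>k. prob (?P i (A k))) sums prob (?P i (\<Union>k. A k))" if i: "i \<in> {1..n}" for i
    proof -
      have "?P i (\<Union>k. A k) = (\<Union>k. ?P i (A k))"
        by auto
      moreover have "disjoint_family (\<lambda>k. ?P i (A k))"
        using union(1) by (auto simp: disjoint_family_on_def)
      ultimately show ?thesis
        using finite_measure_UNION[of "\<lambda>k. ?P i (A k)"] P_events[OF i A] by auto
    qed
    then have "(\<lambda>k. \<Sum>i=1..n. 1 / real n * prob (?P i (A k))) sums
        (\<Sum>i=1..n. 1 / real n * prob (?P i (\<Union>k. A k)))"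
      by (intro sums_sum sums_mult)
    moreover have "(\<lambda>k. prob (A k)) sums prob (\<Union>k. A k)"
      using A union(1) by (intro finite_measure_UNION) auto
    ultimately show ?case
      using union.IH sums_unique2 by simp
  qed
qed

end


section \<open>Uniqueness\<close>

text \<open>
  The bound \<open>cdf \<nu> y \<le> F y\<close> comes from \<open>{..y} \<subseteq> {x. F x \<le> F y}\<close>; the converse bound is approached
  through the sets \<open>{x. F x \<le> s}\<close> with \<open>s < F y\<close>, which are contained in \<open>{..y}\<close> even if \<open>F\<close> is
  constant near \<open>y\<close>.
\<close>

lemma eq_if_cdf_image_uniform:
  assumes "real_distribution \<mu>" "real_distribution \<nu>"
    and image: "\<And>t. measure \<nu> {x. cdf \<mu> x \<le> t} = uniform_cdf t"
  shows "\<nu> = \<mu>"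
proof (rule cdf_unique[OF assms(2,1)], rule ext)
  interpret \<mu>: real_distribution \<mu> by fact
  interpret \<nu>: real_distribution \<nu> by fact
  fix y
  have image': "measure \<nu> {x. cdf \<mu> x \<le> t} = t" if "0 \<le> t" "t \<le> 1" for t
    using image that by (simp add: uniform_cdf_def)
  have "cdf \<nu> y \<le> measure \<nu> {x. cdf \<mu> x \<le> cdf \<mu> y}"
    unfolding cdf_def[of \<nu>] using \<mu>.atMost_subset_cdf_le \<mu>.cdf_le_borel
    by (intro \<nu>.finite_measure_mono) simp_all
  then have le: "cdf \<nu> y \<le> cdf \<mu> y"
    using image' \<mu>.cdf_nonneg \<mu>.cdf_bounded_prob by simp
  have ge: "cdf \<mu> y \<le> cdf \<nu> y" if "0 < cdf \<mu> y"
  proof (rule dense_le_bounded[OF that])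
    fix s assume s: "0 < s" "s < cdf \<mu> y"
    have "{x. cdf \<mu> x \<le> s} \<subseteq> {..y}"
      using \<mu>.cdf_le_subset_atMost s by simp
    then have "measure \<nu> {x. cdf \<mu> x \<le> s} \<le> cdf \<nu> y"
      unfolding cdf_def[of \<nu>] by (intro \<nu>.finite_measure_mono) auto
    then show "s \<le> cdf \<nu> y"
      using image'[of s] s \<mu>.cdf_bounded_prob[of y] by simp
  qed
  show "cdf \<nu> y = cdf \<mu> y"
    using le ge \<mu>.cdf_nonneg[of y] \<nu>.cdf_nonneg[of y] by fastforce
qed

lemma ifs_invariant_f_map_unique:
  assumes \<mu>: "real_distribution \<mu>" and cont: "continuous_on UNIV (cdf \<mu>)" and n: "n \<ge> 2"
    and \<nu>: "real_distribution \<nu>"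
    and inv: "ifs_invariant (cdf_domain \<mu>) n (f_map \<mu> n) (\<lambda>i. 1 / real n) \<nu>"
  shows "\<nu> = \<mu>"
proof -
  interpret \<mu>: real_distribution \<mu> by fact
  interpret \<nu>: real_distribution \<nu> by fact
  let ?D = "cdf_domain \<mu>"
  define G where "G t = measure \<nu> {x. cdf \<mu> x \<le> t}" for t
  have invD: "measure \<nu> B = (\<Sum>i=1..n. 1 / real n * measure \<nu> {x \<in> ?D. f_map \<mu> n i x \<in> B})"
    if "B \<in> sets borel" for B
    using inv that unfolding ifs_invariant_def by blast
  (* The equation for the whole line forces the competitor to live on the domain of the maps. *)
  have D: "measure \<nu> ?D = 1"
    using invD[of UNIV] n \<nu>.prob_space by simp
  have G_self_similar: "G t = (\<Sum>i=1..n. G (real n * t - (real i - 1))) / real n" for t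
  proof -
    have "measure \<nu> {x \<in> ?D. f_map \<mu> n i x \<in> {x. cdf \<mu> x \<le> t}} = G (real n * t - (real i - 1))"
      if i: "i \<in> {1..n}" for i
    proof -
      let ?s = "real n * t - (real i - 1)"
      have "{x \<in> ?D. f_map \<mu> n i x \<in> {x. cdf \<mu> x \<le> t}} = {x. cdf \<mu> x \<le> ?s} \<inter> ?D"
        using \<mu>.cdf_f_map[OF cont _ i] u_map_le_iff[OF i] by auto
      moreover have "{x. cdf \<mu> x \<le> ?s} \<in> sets borel"
        by measurable
      ultimately show ?thesis
        using \<nu>.prob_Int_of_prob_1[OF _ _ D] \<mu>.cdf_domain_borel by (simp add: G_def)
    qed
    then show ?thesis
      using invD[of "{x. cdf \<mu> x \<le> t}"] by (simp add: G_def sum_divide_distrib)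
  qed
  have "G = uniform_cdf"
  proof (rule self_similar_cdf_unique[OF n _ _ _ _ G_self_similar])
    fix t :: real
    show "0 \<le> G t" "G t \<le> 1"
      by (simp_all add: G_def)
    show "G t = 0" if "t \<le> 0"
    proof -
      have "G t \<le> measure \<nu> (space \<nu> - ?D)"
        unfolding G_def using that \<mu>.cdf_domain_borel
        by (intro \<nu>.finite_measure_mono) (auto simp: cdf_domain_def)
      also have "\<dots> = 0"
        using D \<nu>.prob_compl[of ?D] \<mu>.cdf_domain_borel by simp
      finally show ?thesis
        by (simp add: G_def measure_le_0_iff)
    qed
    show "G t = 1" if "1 \<le> t"
    proof -
      have "{x. cdf \<mu> x \<le> t} = space \<nu>"
        using order_trans[OF \<mu>.cdf_bounded_prob that] by auto
      then show ?thesis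
        unfolding G_def by (simp only: \<nu>.prob_space)
    qed
  qed
  then show ?thesis
    using eq_if_cdf_image_uniform[OF \<mu> \<nu>] by (simp add: G_def fun_eq_iff)
qed


section \<open>The measure-attractor\<close>

theorem theorem1:
  fixes \<mu> :: "real measure" and n :: nat
  assumes "real_distribution \<mu>"
    and "continuous_on UNIV (cdf \<mu>)"
    and "n \<ge> 2"
  shows "(\<forall>i\<in>{1..n}. mono_on (cdf_domain \<mu>) (f_map \<mu> n i)) \<and>
         measure_attractor (cdf_domain \<mu>) n (f_map \<mu> n) (\<lambda>i. 1 / real n) \<mu>"
proof -
  interpret real_distribution \<mu> by fact
  have "ifs_with_probs (cdf_domain \<mu>) n (f_map \<mu> n) (\<lambda>i. 1 / real n)"
    unfolding ifs_with_probs_def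
    using cdf_domain_borel f_map_borel_measurable[OF assms(2)] assms(3) by simp
  moreover have "ifs_invariant (cdf_domain \<mu>) n (f_map \<mu> n) (\<lambda>i. 1 / real n) \<mu>"
    using ifs_invariant_f_map assms(2,3) by simp
  ultimately show ?thesis
    using mono_on_f_map[OF assms(2)] ifs_invariant_f_map_unique[OF assms] assms(1)
    unfolding measure_attractor_def by blast
qed

end
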